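(* If a tree sequent $\Gamma\stackrel{\mathcal{T}}{\Rightarrow}\Delta$ is provable in $\mathsf{T}\mathbf{EFL}$, then $\mathfrak{M},f\models\Gamma\stackrel{\mathcal{T}}{\Rightarrow}\Delta$ for all models $\mathfrak{M}$ and all $\mathcal{T}$-assignments $f$ in $\mathfrak{M}$.
   Context: Syntax. Disjoint countably infinite sets $\mathsf{Prop}$ and $\mathsf{Nom}$ (agent nominals). Formulas: $\varphi ::= n \mid p \mid \bot \mid \varphi\to\varphi \mid @_{n}\varphi \mid \mathsf{F}\varphi \mid \Box\varphi$; $\neg\varphi:=\varphi\to\bot$; $\langle\mathsf{F}\rangle\varphi:=\neg\mathsf{F}\neg\varphi$. $@$-prefixed formulas have the form $@_n\varphi$. $\varphi[m/k]$ replaces every occurrence of nominal $k$ by $m$. Semantics. A model $\mathfrak{M}=(W,A,(R_a)_{a\in A},(\asymp_w)_{w\in W},V)$: $W,A$ nonempty, $R_a\subseteq W\times W$, $\asymp_w\subseteq A\times A$, $V:\mathsf{Prop}\cup\mathsf{Nom}\to\mathcal{P}(W\times A)$ with $V(n)=W\times\{\underline n\}$ for a unique $\underline n\in A$. Satisfaction: $(w,a)\models p$ iff $(w,a)\in V(p)$; $(w,a)\models n$ iff $\underline n=a$; $\bot$ never; $\to$ classical; $(w,a)\models@_n\varphi$ iff $(w,\underline n)\models\varphi$; $(w,a)\models\mathsf{F}\varphi$ iff $(w,b)\models\varphi$ for all $b$ with $a\asymp_wb$; $(w,a)\models\Box\varphi$ iff $(v,a)\models\varphi$ for all $v$ with $wR_av$.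 Tree sequents. Labels: natural numbers, and $\alpha\cdot_ni$ (an $n$-child of $\alpha$) for label $\alpha$, nominal $n$, $i\in\mathbb{N}$. A tree: set of labels containing exactly one natural number (root), closed under parents. Labelled formula: $\alpha:\psi$, $\psi$ $@$-prefixed. Tree sequent $\Gamma\stackrel{\mathcal{T}}{\Rightarrow}\Delta$: finite sets of labelled formulas, finite tree containing their labels. $\mathcal{T}$-assignment: $f:\mathcal{T}\to W$ with $f(\alpha)R_{\underline n}f(\beta)$ whenever $\beta\in\mathcal{T}$ is an $n$-child of $\alpha$. $\mathfrak{M},f\models\alpha:@_n\varphi$ iff $(f(\alpha),\underline n)\models\varphi$; $\mathfrak{M},f\models\Gamma\stackrel{\mathcal{T}}{\Rightarrow}\Delta$ iff truth of all of $\Gamma$ implies truth of some member of $\Delta$. Calculus $\mathsf{T}\mathbf{EFL}$ ($\alpha,\beta\in\mathcal{T}$; tree unchanged unless indicated). Initial: $\alpha:@_n\bot,\Gamma\Rightarrow\Delta$; $\alpha:@_n\varphi,\Gamma\Rightarrow\Delta,\alpha:@_n\varphi$. Rules (premises / conclusion): $(\mathsf{rep}_{=1})$ $\alpha:@_nm,\alpha:\varphi[n/k],\Gamma\Rightarrow\Delta$ / $\alpha:@_nm,\alpha:\varphi[m/k],\Gamma\Rightarrow\Delta$; $(\mathsf{rep}_{=2})$ $\alpha:@_nm,\alpha:\varphi[m/k],\Gamma\Rightarrow\Delta$ / $\alpha:@_nm,\alpha:\varphi[n/k],\Gamma\Rightarrow\Delta$; $(\mathsf{ref}_=)$ $\alpha:@_nn,\Gamma\Rightarrow\Delta$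 / $\Gamma\Rightarrow\Delta$; $(\mathsf{rigid}_=)$ $\beta:@_nm,\Gamma\Rightarrow\Delta$ / $\alpha:@_nm,\Gamma\Rightarrow\Delta$; $(\to R)$ $\alpha:@_n\varphi,\Gamma\Rightarrow\Delta,\alpha:@_n\psi$ / $\Gamma\Rightarrow\Delta,\alpha:@_n(\varphi\to\psi)$; $(\to L)$ $\Gamma\Rightarrow\Delta,\alpha:@_n\varphi$ and $\alpha:@_n\psi,\Gamma\Rightarrow\Delta$ / $\alpha:@_n(\varphi\to\psi),\Gamma\Rightarrow\Delta$; $(@R)$ $\Gamma\Rightarrow\Delta,\alpha:@_m\varphi$ / $\Gamma\Rightarrow\Delta,\alpha:@_n@_m\varphi$; $(@L)$ $\alpha:@_m\varphi,\Gamma\Rightarrow\Delta$ / $\alpha:@_n@_m\varphi,\Gamma\Rightarrow\Delta$; $(\mathsf{F}R)$ $\alpha:@_n\langle\mathsf{F}\rangle m,\Gamma\Rightarrow\Delta,\alpha:@_m\varphi$ / $\Gamma\Rightarrow\Delta,\alpha:@_n\mathsf{F}\varphi$, $m$ not occurring in the conclusion; $(\mathsf{F}L)$ $\Gamma\Rightarrow\Delta,\alpha:@_n\langle\mathsf{F}\rangle m$ and $\alpha:@_m\varphi,\Gamma\Rightarrow\Delta$ / $\alpha:@_n\mathsf{F}\varphi,\Gamma\Rightarrow\Delta$; $(\Box R)$ $\Gamma\stackrel{\mathcal{T}\cup\{\alpha\cdot_ni\}}{\Rightarrow}\Delta,\alpha\cdot_ni:@_n\varphi$ / $\Gamma\stackrel{\mathcal{T}}{\Rightarrow}\Delta,\alpha:@_n\Box\varphi$,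 $i$ fresh in the conclusion; $(\Box L)$ $\beta:@_n\varphi,\Gamma\Rightarrow\Delta$ / $\alpha:@_n\Box\varphi,\Gamma\Rightarrow\Delta$, $\beta$ an $n$-child of $\alpha$; $(w\mathsf{lab})$ $\Gamma\stackrel{\mathcal{T}}{\Rightarrow}\Delta$ / $\Gamma\stackrel{\mathcal{T}\cup\{\alpha\}}{\Rightarrow}\Delta$ if $\mathcal{T}\cup\{\alpha\}$ is a tree; $(Cut)$ $\Gamma\Rightarrow\Delta,\alpha:@_n\varphi$ and $\alpha:@_n\varphi,\Pi\Rightarrow\Sigma$ / $\Gamma,\Pi\Rightarrow\Delta,\Sigma$. Provable = root of a finite derivation. *)

theory Defs
  imports Main
begin

datatype propvar = Prop nat
datatype nom = Nom nat

datatype fm =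
    NomF nom
  | PropF propvar
  | Bot
  | Imp fm fm
  | At nom fm
  | Fr fm
  | Box fm

definition Neg :: "fm \<Rightarrow> fm" where
  "Neg \<phi> = Imp \<phi> Bot"

definition DiaFr :: "fm \<Rightarrow> fm" where
  "DiaFr \<phi> = Neg (Fr (Neg \<phi>))"

definition at_prefixed :: "fm \<Rightarrow> bool" where
  "at_prefixed \<psi> \<longleftrightarrow> (\<exists>n \<phi>. \<psi> = At n \<phi>)"

definition repl_nom :: "nom \<Rightarrow> nom \<Rightarrow> nom \<Rightarrow> nom" where
  "repl_nom m k n = (if n = k then m else n)"

(* \<open>subst m k \<phi>\<close> is \<phi>[m/k]; the subscripts of @ are replaced as well. *)
primrec subst :: "nom \<Rightarrow> nom \<Rightarrow> fm \<Rightarrow> fm" where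
  "subst m k (NomF n) = NomF (repl_nom m k n)"
| "subst m k (PropF p) = PropF p"
| "subst m k Bot = Bot"
| "subst m k (Imp \<phi> \<psi>) = Imp (subst m k \<phi>) (subst m k \<psi>)"
| "subst m k (At n \<phi>) = At (repl_nom m k n) (subst m k \<phi>)"
| "subst m k (Fr \<phi>) = Fr (subst m k \<phi>)"
| "subst m k (Box \<phi>) = Box (subst m k \<phi>)"

primrec fm_noms :: "fm \<Rightarrow> nom set" where
  "fm_noms (NomF n) = {n}"
| "fm_noms (PropF p) = {}"
| "fm_noms Bot = {}"
| "fm_noms (Imp \<phi> \<psi>) = fm_noms \<phi> \<union> fm_noms \<psi>"
| "fm_noms (At n \<phi>) = insert n (fm_noms \<phi>)"
| "fm_noms (Fr \<phi>) = fm_noms \<phi>"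
| "fm_noms (Box \<phi>) = fm_noms \<phi>"


record ('w, 'a) model =
  worlds :: "'w set"
  agents :: "'a set"
  acc :: "'a \<Rightarrow> ('w \<times> 'w) set"
  friend :: "'w \<Rightarrow> ('a \<times> 'a) set"
  val :: "propvar + nom \<Rightarrow> ('w \<times> 'a) set"

definition is_model :: "('w, 'a) model \<Rightarrow> bool" where
  "is_model M \<longleftrightarrow>
     worlds M \<noteq> {} \<and> agents M \<noteq> {} \<and>
     (\<forall>a \<in> agents M. acc M a \<subseteq> worlds M \<times> worlds M) \<and>
     (\<forall>w \<in> worlds M. friend M w \<subseteq> agents M \<times> agents M) \<and>
     (\<forall>p. val M (Inl p) \<subseteq> worlds M \<times> agents M) \<and>
     (\<forall>n. \<exists>!a. a \<in> agents M \<and> val M (Inr n) = worlds M \<times> {a})"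

definition denot :: "('w, 'a) model \<Rightarrow> nom \<Rightarrow> 'a" where
  "denot M n = (THE a. a \<in> agents M \<and> val M (Inr n) = worlds M \<times> {a})"

primrec sat :: "('w, 'a) model \<Rightarrow> 'w \<Rightarrow> 'a \<Rightarrow> fm \<Rightarrow> bool" where
  "sat M w a (NomF n) \<longleftrightarrow> denot M n = a"
| "sat M w a (PropF p) \<longleftrightarrow> (w, a) \<in> val M (Inl p)"
| "sat M w a Bot \<longleftrightarrow> False"
| "sat M w a (Imp \<phi> \<psi>) \<longleftrightarrow> (sat M w a \<phi> \<longrightarrow> sat M w a \<psi>)"
| "sat M w a (At n \<phi>) \<longleftrightarrow> sat M w (denot M n) \<phi>"
| "sat M w a (Fr \<phi>) \<longleftrightarrow> (\<forall>b. (a, b) \<in> friend M w \<longrightarrow> sat M w b \<phi>)"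
| "sat M w a (Box \<phi>) \<longleftrightarrow> (\<forall>v. (w, v) \<in> acc M a \<longrightarrow> sat M v a \<phi>)"


datatype label = Root nat | Child label nom nat

primrec label_noms :: "label \<Rightarrow> nom set" where
  "label_noms (Root i) = {}"
| "label_noms (Child \<alpha> n i) = insert n (label_noms \<alpha>)"

primrec label_nats :: "label \<Rightarrow> nat set" where
  "label_nats (Root i) = {i}"
| "label_nats (Child \<alpha> n i) = insert i (label_nats \<alpha>)"

definition is_tree :: "label set \<Rightarrow> bool" where
  "is_tree T \<longleftrightarrow>
     (\<exists>!i. Root i \<in> T) \<and> (\<forall>\<alpha> n i. Child \<alpha> n i \<in> T \<longrightarrow> \<alpha> \<in> T)"

(* The formula component is required to be @-prefixed in tree_sequent. *)
type_synonym lfm = "label \<times> fm"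

definition tree_sequent :: "lfm set \<Rightarrow> label set \<Rightarrow> lfm set \<Rightarrow> bool" where
  "tree_sequent \<Gamma> T \<Delta> \<longleftrightarrow>
     finite \<Gamma> \<and> finite \<Delta> \<and> finite T \<and> is_tree T \<and>
     (\<forall>(\<alpha>, \<psi>) \<in> \<Gamma> \<union> \<Delta>. \<alpha> \<in> T \<and> at_prefixed \<psi>)"

definition sequent_noms :: "lfm set \<Rightarrow> label set \<Rightarrow> lfm set \<Rightarrow> nom set" where
  "sequent_noms \<Gamma> T \<Delta> =
     (\<Union>\<alpha> \<in> T. label_noms \<alpha>) \<union>
     (\<Union>(\<alpha>, \<psi>) \<in> \<Gamma> \<union> \<Delta>. label_noms \<alpha> \<union> fm_noms \<psi>)"

definition sequent_nats :: "lfm set \<Rightarrow> label set \<Rightarrow> lfm set \<Rightarrow> nat set" where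
  "sequent_nats \<Gamma> T \<Delta> =
     (\<Union>\<alpha> \<in> T. label_nats \<alpha>) \<union> (\<Union>(\<alpha>, \<psi>) \<in> \<Gamma> \<union> \<Delta>. label_nats \<alpha>)"

definition assignment :: "('w, 'a) model \<Rightarrow> label set \<Rightarrow> (label \<Rightarrow> 'w) \<Rightarrow> bool" where
  "assignment M T f \<longleftrightarrow>
     (\<forall>\<alpha> \<in> T. f \<alpha> \<in> worlds M) \<and>
     (\<forall>\<alpha> n i. \<alpha> \<in> T \<longrightarrow> Child \<alpha> n i \<in> T \<longrightarrow>
        (f \<alpha>, f (Child \<alpha> n i)) \<in> acc M (denot M n))"

definition lsat :: "('w, 'a) model \<Rightarrow> (label \<Rightarrow> 'w) \<Rightarrow> lfm \<Rightarrow> bool" where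
  "lsat M f x \<longleftrightarrow> (\<exists>\<alpha> n \<phi>. x = (\<alpha>, At n \<phi>) \<and> sat M (f \<alpha>) (denot M n) \<phi>)"

definition sequent_sat ::
    "('w, 'a) model \<Rightarrow> (label \<Rightarrow> 'w) \<Rightarrow> lfm set \<Rightarrow> lfm set \<Rightarrow> bool" where
  "sequent_sat M f \<Gamma> \<Delta> \<longleftrightarrow> ((\<forall>x \<in> \<Gamma>. lsat M f x) \<longrightarrow> (\<exists>y \<in> \<Delta>. lsat M f y))"


(* Every derivable triple is a tree sequent (provable_tree_sequent below), so side
   conditions such as \<open>\<alpha> \<in> T\<close> are stated only where the premises do not force them. *)
inductive provable :: "lfm set \<Rightarrow> label set \<Rightarrow> lfm set \<Rightarrow> bool" where
  init_bot:
    "tree_sequent (insert (\<alpha>, At n Bot) \<Gamma>) T \<Delta> \<Longrightarrow>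
     provable (insert (\<alpha>, At n Bot) \<Gamma>) T \<Delta>"
| init_id:
    "tree_sequent (insert (\<alpha>, At n \<phi>) \<Gamma>) T (insert (\<alpha>, At n \<phi>) \<Delta>) \<Longrightarrow>
     provable (insert (\<alpha>, At n \<phi>) \<Gamma>) T (insert (\<alpha>, At n \<phi>) \<Delta>)"
| rep_eq1:
    "provable (insert (\<alpha>, At n (NomF m)) (insert (\<alpha>, subst n k \<phi>) \<Gamma>)) T \<Delta> \<Longrightarrow>
     provable (insert (\<alpha>, At n (NomF m)) (insert (\<alpha>, subst m k \<phi>) \<Gamma>)) T \<Delta>"
| rep_eq2:
    "provable (insert (\<alpha>, At n (NomF m)) (insert (\<alpha>, subst m k \<phi>) \<Gamma>)) T \<Delta> \<Longrightarrow>
     provable (insert (\<alpha>, At n (NomF m)) (insert (\<alpha>, subst n k \<phi>) \<Gamma>)) T \<Delta>"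
| ref_eq:
    "provable (insert (\<alpha>, At n (NomF n)) \<Gamma>) T \<Delta> \<Longrightarrow>
     provable \<Gamma> T \<Delta>"
| rigid_eq:
    "provable (insert (\<beta>, At n (NomF m)) \<Gamma>) T \<Delta> \<Longrightarrow> \<alpha> \<in> T \<Longrightarrow>
     provable (insert (\<alpha>, At n (NomF m)) \<Gamma>) T \<Delta>"
| ImpR:
    "provable (insert (\<alpha>, At n \<phi>) \<Gamma>) T (insert (\<alpha>, At n \<psi>) \<Delta>) \<Longrightarrow>
     provable \<Gamma> T (insert (\<alpha>, At n (Imp \<phi> \<psi>)) \<Delta>)"
| ImpL:
    "provable \<Gamma> T (insert (\<alpha>, At n \<phi>) \<Delta>) \<Longrightarrow>
     provable (insert (\<alpha>, At n \<psi>) \<Gamma>) T \<Delta> \<Longrightarrow>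
     provable (insert (\<alpha>, At n (Imp \<phi> \<psi>)) \<Gamma>) T \<Delta>"
| AtR:
    "provable \<Gamma> T (insert (\<alpha>, At m \<phi>) \<Delta>) \<Longrightarrow>
     provable \<Gamma> T (insert (\<alpha>, At n (At m \<phi>)) \<Delta>)"
| AtL:
    "provable (insert (\<alpha>, At m \<phi>) \<Gamma>) T \<Delta> \<Longrightarrow>
     provable (insert (\<alpha>, At n (At m \<phi>)) \<Gamma>) T \<Delta>"
| FrR:
    "provable (insert (\<alpha>, At n (DiaFr (NomF m))) \<Gamma>) T (insert (\<alpha>, At m \<phi>) \<Delta>) \<Longrightarrow>
     m \<notin> sequent_noms \<Gamma> T (insert (\<alpha>, At n (Fr \<phi>)) \<Delta>) \<Longrightarrow>
     provable \<Gamma> T (insert (\<alpha>, At n (Fr \<phi>)) \<Delta>)"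
| FrL:
    "provable \<Gamma> T (insert (\<alpha>, At n (DiaFr (NomF m))) \<Delta>) \<Longrightarrow>
     provable (insert (\<alpha>, At m \<phi>) \<Gamma>) T \<Delta> \<Longrightarrow>
     provable (insert (\<alpha>, At n (Fr \<phi>)) \<Gamma>) T \<Delta>"
| BoxR:
    "provable \<Gamma> (insert (Child \<alpha> n i) T) (insert (Child \<alpha> n i, At n \<phi>) \<Delta>) \<Longrightarrow>
     tree_sequent \<Gamma> T (insert (\<alpha>, At n (Box \<phi>)) \<Delta>) \<Longrightarrow>
     i \<notin> sequent_nats \<Gamma> T (insert (\<alpha>, At n (Box \<phi>)) \<Delta>) \<Longrightarrow>
     provable \<Gamma> T (insert (\<alpha>, At n (Box \<phi>)) \<Delta>)"
| BoxL:
    "provable (insert (Child \<alpha> n i, At n \<phi>) \<Gamma>) T \<Delta> \<Longrightarrow>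
     provable (insert (\<alpha>, At n (Box \<phi>)) \<Gamma>) T \<Delta>"
| wlab:
    "provable \<Gamma> T \<Delta> \<Longrightarrow> is_tree (insert \<alpha> T) \<Longrightarrow>
     provable \<Gamma> (insert \<alpha> T) \<Delta>"
| Cut:
    "provable \<Gamma> T (insert (\<alpha>, At n \<phi>) \<Delta>) \<Longrightarrow>
     provable (insert (\<alpha>, At n \<phi>) \<Pi>) T \<Sigma> \<Longrightarrow>
     provable (\<Gamma> \<union> \<Pi>) T (\<Delta> \<union> \<Sigma>)"

lemma at_prefixed_At [simp]: "at_prefixed (At n \<phi>)"
  by (simp add: at_prefixed_def)

lemma at_prefixed_subst [simp]: "at_prefixed (subst m k \<phi>) \<longleftrightarrow> at_prefixed \<phi>"
  by (cases \<phi>) (simp_all add: at_prefixed_def)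

lemma provable_tree_sequent: "provable \<Gamma> T \<Delta> \<Longrightarrow> tree_sequent \<Gamma> T \<Delta>"
proof (induction rule: provable.induct)
  case (BoxL \<alpha> n i \<phi> \<Gamma> T \<Delta>)
  then have "\<alpha> \<in> T"
    unfolding tree_sequent_def is_tree_def by blast
  with BoxL show ?case by (auto simp: tree_sequent_def)
qed (auto simp: tree_sequent_def)

end

theory Submission
  imports Defs
begin

text \<open>
  Induction on the derivation, for all models and assignments at once. The fresh nominal of
  the rule for \<open>F\<close> on the right is absorbed by reinterpreting it as a counterexample agent:
  as it occurs neither in the formulas nor in the tree labels, the assignment and the rest of
  the sequent are unaffected. The fresh label of the rule for the box is likewise
  absorbed by updating the assignment.
\<close>

lemma denot_eqI:
  assumes "is_model M" "a \<in> agents M" "val M (Inr n) = worlds M \<times> {a}"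
  shows "denot M n = a"
  unfolding denot_def using assms by (intro the_equality) (auto simp: is_model_def)

lemma denot_in_agents:
  assumes "is_model M"
  shows "denot M n \<in> agents M"
proof -
  have "\<exists>!a. a \<in> agents M \<and> val M (Inr n) = worlds M \<times> {a}"
    using assms by (simp add: is_model_def)
  from theI'[OF this] show ?thesis by (simp add: denot_def)
qed

lemma lsat_At [simp]: "lsat M f (\<alpha>, At n \<phi>) \<longleftrightarrow> sat M (f \<alpha>) (denot M n) \<phi>"
  by (simp add: lsat_def)

lemma lsat_not_at_prefixed: "\<not> at_prefixed \<psi> \<Longrightarrow> \<not> lsat M f (\<alpha>, \<psi>)"
  by (auto simp: lsat_def at_prefixed_def)

text \<open>The diamond asks for some friend denoted by \<open>m\<close>; as \<open>m\<close>
  denotes a single agent, the quantifier collapses.\<close>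

lemma sat_DiaFr_NomF [simp]:
  "sat M w a (DiaFr (NomF m)) \<longleftrightarrow> (a, denot M m) \<in> friend M w"
  by (auto simp: DiaFr_def Neg_def)

text \<open>The two instances differ only in naming one agent by \<open>n\<close> or by
  \<open>m\<close>, and satisfaction consults a nominal only through \<open>denot\<close>.\<close>

lemma sat_subst_cong:
  assumes "denot M n = denot M m"
  shows "sat M w a (subst n k \<phi>) \<longleftrightarrow> sat M w a (subst m k \<phi>)"
  using assms by (induction \<phi> arbitrary: w a) (auto simp: repl_nom_def)

text \<open>The outermost nominal of an @-prefixed \<open>\<phi>\<close> may itself be
  \<open>k\<close>, so its denotation is compared separately from the body. If \<open>\<phi>\<close>
  is not @-prefixed, both sides are false.\<close>

lemma lsat_subst_cong:
  assumes "denot M n = denot M m"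
  shows "lsat M f (\<alpha>, subst n k \<phi>) \<longleftrightarrow> lsat M f (\<alpha>, subst m k \<phi>)"
proof (cases "at_prefixed \<phi>")
  case True
  then obtain l \<psi> where "\<phi> = At l \<psi>" by (auto simp: at_prefixed_def)
  then show ?thesis
    using assms sat_subst_cong[OF assms] by (auto simp: repl_nom_def)
qed (simp add: lsat_not_at_prefixed)

definition set_nom :: "nom \<Rightarrow> 'a \<Rightarrow> ('w, 'a) model \<Rightarrow> ('w, 'a) model" where
  "set_nom m b M = M\<lparr>val := (val M)(Inr m := worlds M \<times> {b})\<rparr>"

lemma set_nom_simps [simp]:
  "worlds (set_nom m b M) = worlds M"
  "agents (set_nom m b M) = agents M"
  "acc (set_nom m b M) = acc M"
  "friend (set_nom m b M) = friend M"
  "val (set_nom m b M) (Inl p) = val M (Inl p)"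
  by (simp_all add: set_nom_def)

lemma is_model_set_nom:
  assumes "is_model M" "b \<in> agents M"
  shows "is_model (set_nom m b M)"
proof -
  have "\<exists>!a. a \<in> agents M \<and> val (set_nom m b M) (Inr k) = worlds M \<times> {a}" for k
  proof (cases "k = m")
    case True
    \<comment> \<open>The agent is unique because \<open>worlds M\<close> is nonempty, so that
      \<open>worlds M \<times> {a}\<close> determines \<open>a\<close>.\<close>
    with assms show ?thesis
      by (auto simp: is_model_def set_nom_def times_eq_iff)
  next
    case False
    with assms show ?thesis
      by (simp add: is_model_def set_nom_def)
  qed
  then show ?thesis
    using assms by (simp add: is_model_def)
qed

lemma denot_set_nom_same:
  assumes "is_model M" "b \<in> agents M"
  shows "denot (set_nom m b M) m = b"
  using is_model_set_nom[OF assms] assms(2)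
  by (intro denot_eqI) (auto simp: set_nom_def)

lemma denot_set_nom_other: "k \<noteq> m \<Longrightarrow> denot (set_nom m b M) k = denot M k"
  by (simp add: denot_def set_nom_def)

lemma sat_set_nom:
  "m \<notin> fm_noms \<phi> \<Longrightarrow> sat (set_nom m b M) w a \<phi> \<longleftrightarrow> sat M w a \<phi>"
  by (induction \<phi> arbitrary: w a) (auto simp: denot_set_nom_other)

lemma lsat_set_nom:
  "m \<notin> fm_noms \<psi> \<Longrightarrow> lsat (set_nom m b M) f (\<alpha>, \<psi>) \<longleftrightarrow> lsat M f (\<alpha>, \<psi>)"
  by (auto simp: lsat_def sat_set_nom denot_set_nom_other)

text \<open>Labels contain nominals: the edge to \<open>Child \<alpha> n i\<close> must lie in the
  relation of the agent named \<open>n\<close>. Freshness of \<open>m\<close> for the labels keeps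
  these agents, hence all edge conditions, unchanged.\<close>

lemma assignment_set_nom:
  assumes "assignment M T f" "\<forall>\<alpha> \<in> T. m \<notin> label_noms \<alpha>"
  shows "assignment (set_nom m b M) T f"
proof -
  have "denot (set_nom m b M) n = denot M n" if "Child \<alpha> n i \<in> T" for \<alpha> n i
    using assms(2) that by (intro denot_set_nom_other) auto
  with assms(1) show ?thesis by (auto simp: assignment_def)
qed

text \<open>The new node is a leaf, so the edge from its parent is the only new edge
  condition.\<close>

lemma assignment_update_child:
  assumes "assignment M T f" "is_tree T" "Child \<alpha> n i \<notin> T"
    and "v \<in> worlds M" "(f \<alpha>, v) \<in> acc M (denot M n)"
  shows "assignment M (insert (Child \<alpha> n i) T) (f(Child \<alpha> n i := v))"
proof -
  \<comment> \<open>Hence the update leaves the world of the parent alone.\<close>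
  have "\<alpha> \<noteq> Child \<alpha> n i" by (induction \<alpha> arbitrary: n i) auto
  \<comment> \<open>Closure under parents would otherwise put the new label into
    \<open>T\<close>.\<close>
  moreover have "Child (Child \<alpha> n i) k j \<notin> T" for k j
    using assms(2,3) by (auto simp: is_tree_def)
  ultimately show ?thesis
    using assms by (auto simp: assignment_def)
qed

lemma lsat_update_other: "\<beta> \<noteq> \<alpha> \<Longrightarrow> lsat M (f(\<alpha> := v)) (\<beta>, \<psi>) \<longleftrightarrow> lsat M f (\<beta>, \<psi>)"
  by (simp add: lsat_def)

text \<open>\<open>IH\<close> ranges over all models because it is applied to
  \<open>set_nom m b M\<close>, where \<open>b\<close> is a friend refuting \<open>\<phi>\<close>: a
  countermodel of the conclusion becomes one of the premise.\<close>

lemma FrR_sound: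
  fixes M :: "('w, 'a) model"
  assumes IH: "\<And>(M :: ('w, 'a) model) f. is_model M \<Longrightarrow> assignment M T f \<Longrightarrow>
      sequent_sat M f (insert (\<alpha>, At n (DiaFr (NomF m))) \<Gamma>) (insert (\<alpha>, At m \<phi>) \<Delta>)"
    and fresh: "m \<notin> sequent_noms \<Gamma> T (insert (\<alpha>, At n (Fr \<phi>)) \<Delta>)"
    and "\<alpha> \<in> T" and M: "is_model M" and f: "assignment M T f"
  shows "sequent_sat M f \<Gamma> (insert (\<alpha>, At n (Fr \<phi>)) \<Delta>)"
  unfolding sequent_sat_def
proof (intro impI, rule ccontr)
  assume \<Gamma>: "\<forall>x\<in>\<Gamma>. lsat M f x"
    and "\<not> (\<exists>y\<in>insert (\<alpha>, At n (Fr \<phi>)) \<Delta>. lsat M f y)"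
  then have \<Delta>: "\<forall>y\<in>\<Delta>. \<not> lsat M f y" and "\<not> sat M (f \<alpha>) (denot M n) (Fr \<phi>)"
    by auto
  then obtain b where b: "(denot M n, b) \<in> friend M (f \<alpha>)" "\<not> sat M (f \<alpha>) b \<phi>"
    by auto
  \<comment> \<open>\<open>is_model\<close> confines \<open>friend M w\<close> to agents only for
    \<open>w\<close> in \<open>worlds M\<close>.\<close>
  have "f \<alpha> \<in> worlds M" using f \<open>\<alpha> \<in> T\<close> by (simp add: assignment_def)
  with M b(1) have bA: "b \<in> agents M" by (auto simp: is_model_def)
  let ?N = "set_nom m b M"
  have noms: "n \<noteq> m" "m \<notin> fm_noms \<phi>" "\<forall>\<beta>\<in>T. m \<notin> label_noms \<beta>"
    "\<And>\<beta> \<psi>. (\<beta>, \<psi>) \<in> \<Gamma> \<union> \<Delta> \<Longrightarrow> m \<notin> fm_noms \<psi>"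
    using fresh by (auto simp: sequent_noms_def)
  have "sequent_sat ?N f (insert (\<alpha>, At n (DiaFr (NomF m))) \<Gamma>) (insert (\<alpha>, At m \<phi>) \<Delta>)"
    using IH is_model_set_nom[OF M bA] assignment_set_nom[OF f noms(3)] .
  moreover have "lsat ?N f x \<longleftrightarrow> lsat M f x" if "x \<in> \<Gamma> \<union> \<Delta>" for x
    using that noms(4) lsat_set_nom by (metis surj_pair)
  moreover have "lsat ?N f (\<alpha>, At n (DiaFr (NomF m)))"
    using b(1) noms(1) by (simp add: denot_set_nom_same[OF M bA] denot_set_nom_other)
  moreover have "\<not> lsat ?N f (\<alpha>, At m \<phi>)"
    using b(2) noms(2) by (simp add: denot_set_nom_same[OF M bA] sat_set_nom)
  ultimately show False
    using \<Gamma> \<Delta> by (auto simp: sequent_sat_def simp del: lsat_At)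
qed

text \<open>The model stays fixed here; sending the fresh child to a successor that refutes
  \<open>\<phi>\<close> turns a falsifying assignment for the conclusion into one for the
  premise.\<close>

lemma BoxR_sound:
  assumes IH: "\<And>f. assignment M (insert (Child \<alpha> n i) T) f \<Longrightarrow>
      sequent_sat M f \<Gamma> (insert (Child \<alpha> n i, At n \<phi>) \<Delta>)"
    and seq: "tree_sequent \<Gamma> T (insert (\<alpha>, At n (Box \<phi>)) \<Delta>)"
    and fresh: "i \<notin> sequent_nats \<Gamma> T (insert (\<alpha>, At n (Box \<phi>)) \<Delta>)"
    and M: "is_model M" and f: "assignment M T f"
  shows "sequent_sat M f \<Gamma> (insert (\<alpha>, At n (Box \<phi>)) \<Delta>)"
  unfolding sequent_sat_def
proof (intro impI, rule ccontr)
  assume \<Gamma>: "\<forall>x\<in>\<Gamma>. lsat M f x"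
    and "\<not> (\<exists>y\<in>insert (\<alpha>, At n (Box \<phi>)) \<Delta>. lsat M f y)"
  then have \<Delta>: "\<forall>y\<in>\<Delta>. \<not> lsat M f y" and "\<not> sat M (f \<alpha>) (denot M n) (Box \<phi>)"
    by auto
  then obtain v where v: "(f \<alpha>, v) \<in> acc M (denot M n)" "\<not> sat M v (denot M n) \<phi>"
    by auto
  \<comment> \<open>\<open>is_model\<close> bounds \<open>acc M a\<close> only for agents
    \<open>a\<close>, hence the use of \<open>denot_in_agents\<close>.\<close>
  have vW: "v \<in> worlds M"
    using M v(1) denot_in_agents[OF M, of n] by (auto simp: is_model_def)
  \<comment> \<open>The number \<open>i\<close> occurs in this label but in no label of
    \<open>T\<close>.\<close>
  have new: "Child \<alpha> n i \<notin> T"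
    using fresh by (fastforce simp: sequent_nats_def)
  let ?g = "f(Child \<alpha> n i := v)"
  have "is_tree T" using seq by (simp add: tree_sequent_def)
  then have "sequent_sat M ?g \<Gamma> (insert (Child \<alpha> n i, At n \<phi>) \<Delta>)"
    by (intro IH assignment_update_child f new vW v(1))
  moreover have "lsat M ?g x \<longleftrightarrow> lsat M f x" if "x \<in> \<Gamma> \<union> \<Delta>" for x
  proof (cases x)
    case (Pair \<beta> \<psi>)
    with seq that have "\<beta> \<in> T" by (auto simp: tree_sequent_def)
    with new have "\<beta> \<noteq> Child \<alpha> n i" by blast
    with Pair show ?thesis by (simp add: lsat_update_other)
  qed
  moreover have "\<not> lsat M ?g (Child \<alpha> n i, At n \<phi>)"
    using v(2) by simp
  ultimately show False
    using \<Gamma> \<Delta> by (auto simp: sequent_sat_def simp del: lsat_At)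
qed

theorem theorem1:
  fixes \<Gamma> \<Delta> :: "lfm set" and T :: "label set"
    and M :: "('w, 'a) model" and f :: "label \<Rightarrow> 'w"
  assumes "provable \<Gamma> T \<Delta>"
    and "is_model M"
    and "assignment M T f"
  shows "sequent_sat M f \<Gamma> \<Delta>"
  using assms
proof (induction arbitrary: M f rule: provable.induct)
  case (rep_eq1 \<alpha> n m k \<phi> \<Gamma> T \<Delta>)
  \<comment> \<open>When the antecedent holds, its equality formula gives
    \<open>denot M n = denot M m\<close>, as \<open>lsat_subst_cong\<close> requires.\<close>
  then show ?case
    using lsat_subst_cong[of M n m f \<alpha> k \<phi>] by (auto simp: sequent_sat_def)
next
  case (rep_eq2 \<alpha> n m k \<phi> \<Gamma> T \<Delta>)
  then show ?case
    using lsat_subst_cong[of M n m f \<alpha> k \<phi>] by (auto simp: sequent_sat_def)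
next
  case (FrR \<alpha> n m \<Gamma> T \<phi> \<Delta>)
  have "\<alpha> \<in> T"
    using provable_tree_sequent[OF FrR.hyps(1)] by (simp add: tree_sequent_def)
  then show ?case
    using FrR_sound[OF FrR.IH FrR.hyps(2) _ FrR.prems] by simp
next
  case (BoxR \<Gamma> \<alpha> n i T \<phi> \<Delta>)
  show ?case
    using BoxR_sound[OF BoxR.IH[OF BoxR.prems(1)] BoxR.hyps(2,3) BoxR.prems] by simp
next
  case (BoxL \<alpha> n i \<phi> \<Gamma> T \<Delta>)
  \<comment> \<open>The premise has a formula at the child, so that label lies in \<open>T\<close>,
    and closure under parents supplies \<open>\<alpha>\<close>.\<close>
  have "Child \<alpha> n i \<in> T" "\<alpha> \<in> T"
    using provable_tree_sequent[OF BoxL.hyps]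
    unfolding tree_sequent_def is_tree_def by blast+
  then have "(f \<alpha>, f (Child \<alpha> n i)) \<in> acc M (denot M n)"
    using BoxL.prems(2) by (simp add: assignment_def)
  with BoxL.IH[OF BoxL.prems] show ?case
    by (auto simp: sequent_sat_def)
next
  case (wlab \<Gamma> T \<Delta> \<alpha>)
  \<comment> \<open>An assignment on the larger tree restricts to the smaller one.\<close>
  then have "assignment M T f" by (simp add: assignment_def)
  with wlab show ?case by blast
next
  case (Cut \<Gamma> T \<alpha> n \<phi> \<Delta> \<Pi> \<Sigma>)
  from Cut.IH(1)[OF Cut.prems] Cut.IH(2)[OF Cut.prems] show ?case
    by (auto simp: sequent_sat_def)
next
  case (ImpL \<Gamma> T \<alpha> n \<phi> \<Delta> \<psi>)
  from ImpL.IH(1)[OF ImpL.prems] ImpL.IH(2)[OF ImpL.prems] show ?case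
    by (auto simp: sequent_sat_def)
next
  case (FrL \<Gamma> T \<alpha> n m \<Delta> \<phi>)
  from FrL.IH(1)[OF FrL.prems] FrL.IH(2)[OF FrL.prems] show ?case
    by (auto simp: sequent_sat_def)
\<comment> \<open>Among the remaining rules, \<open>rigid_eq\<close> is sound because
  \<open>denot\<close> does not depend on the world, and \<open>AtR\<close> and \<open>AtL\<close>
  because the truth of \<open>At m \<phi>\<close> does not depend on the current agent.\<close>
qed (fastforce simp: sequent_sat_def)+

end
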